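(* $\mathrm{InteriorG}(\mathrm{Gspace})\equiv\mathrm{Gspace}$.
   Context: Logic is classical. Names form a type $N$; a name may designate zero, one or several objects. The relation $\eta : N\to N\to \mathrm{Prop}$ (singular inclusion) is governed by Leśniewski's Ontology: $\eta\,A\,b$ holds iff [there is $C$ with $\eta\,C\,A$] and [for all $C,D$, $\eta\,C\,A$ and $\eta\,D\,A$ imply $\eta\,C\,D$] and [for all $C$, $\eta\,C\,A$ implies $\eta\,C\,b$]; i.e. $A$ designates exactly one object, which is among those designated by $b$. $A$ is an Individual iff $\eta\,A\,A$. Notation: $P\equiv Q$ iff $\eta\,P\,Q$ and $\eta\,Q\,P$; $a\approx b$ iff $\forall P,\ \eta\,P\,a\leftrightarrow\eta\,P\,b$; $a\subseteq b$ iff $\forall P,\ \eta\,P\,a\to\eta\,P\,b$. Names with the same extension are interchangeable. Name-forming operators are introduced by stating when $\eta\,P\,(\cdot)$ holds. Mereology: $\eta\,P\,(\mathrm{pt}(Q))$ ("$P$ is a part of $Q$") relates individuals and is reflexive on individuals, transitive, and antisymmetric up to $\equiv$; $\eta\,P\,(\mathrm{ppt}(Q))$ (proper part) means $\eta\,P\,(\mathrm{pt}(Q))$ and not $P\equiv Q$; $\eta\,P\,(\mathrm{ext}(Q))$ means $P,Q$ are individuals with no common part. $\eta\,A\,(\mathrm{klass}(a))$ iff $A$ is an Individual, every $B$ with $\eta\,B\,a$ satisfies $\eta\,B\,(\mathrm{pt}(A))$, and for every $B$ with $\eta\,B\,(\mathrm{pt}(A))$ there exist $C,D$ with $\eta\,C\,a$,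 $\eta\,D\,(\mathrm{pt}(C))$, $\eta\,D\,(\mathrm{pt}(B))$. If some $C$ satisfies $\eta\,C\,a$, then there is $A$ with $\eta\,A\,(\mathrm{klass}(a))$, unique up to $\equiv$. Geometry: $\mathrm{balls}$ is a primitive name whose members are individuals (balls); at least one ball exists. $\eta\,P\,(\mathrm{Concent}(Q))$ means that the balls $P,Q$ are concentric in Tarski's sense: $P\equiv Q$; or $P$ is a proper part of $Q$ and any two balls $X,Y$ externally diametrical to $P$ and internally tangent to $Q$ are internally diametrical to $Q$; or the same with $P,Q$ exchanged. Here (all variables balls): $A$ is externally tangent to $B$ if $A$ is external to $B$ and of any two balls $X,Y$ having $A$ as part and external to $B$ one is part of the other; $A$ is internally tangent to $B$ if $A$ is a proper part of $B$ and of any two balls $X,Y$ having $A$ as part and being parts of $B$ one is part of the other; $A,B$ are externally diametrical to $C$ if both are externally tangent to $C$ and whenever $X,Y$ are external to $C$, $A$ is part of $X$ and $B$ is part of $Y$, then $X$ is external to $Y$; $A,B$ are internally diametrical to $C$ if both are internally tangent to $C$ and whenever $X,Y$ are external to $C$, $A$ is externally tangent to $X$ and $B$ to $Y$, then $X$ is external to $Y$. $\eta\,P\,(\mathrm{Point}(Q))$ iff $\eta\,P\,\mathrm{balls}$, $\eta\,Q\,\mathrm{balls}$ and $\eta\,P\,(\mathrm{Concent}(Q))$. Standing assumptions: concentricity is an equivalence relation on balls, and concentric balls $P,Q$ satisfy $\mathrm{Point}(P)\approx\mathrm{Point}(Q)$. $\eta\,P\,\mathrm{Solid}$ iff $P$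 is an Individual and there is $b\subseteq\mathrm{balls}$ with $\eta\,P\,(\mathrm{klass}(b))$; parts of solids are assumed to be solids. $\eta\,P\,\mathrm{Gspace}$ iff $\eta\,P\,(\mathrm{klass}(\mathrm{balls}))$. $\eta\,P\,(\mathrm{sat\_InteriorPoint}(Q))$ iff $\eta\,Q\,\mathrm{Solid}$ and there is $P'$ with $\eta\,P\,(\mathrm{Point}(P'))$, $\eta\,P'\,(\mathrm{pt}(Q))$, and ($\eta\,P'\,(\mathrm{pt}(P))\to P\equiv P'$). $\eta\,P\,(\mathrm{InteriorG}(Q))$ iff $\eta\,P\,(\mathrm{klass}(\mathrm{sat\_InteriorPoint}(Q)))$. *)

theory Defs
  imports Main
begin

text \<open>
  Name-forming operators are functions on the type of names, each fixed together with the
  clause that says when \<open>\<eta> P (\<dots>)\<close> holds. Every such clause only admits individuals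
  on its left-hand side, as required by the axiom of Ontology.
\<close>

locale ontology =
  fixes \<eta> :: "'n \<Rightarrow> 'n \<Rightarrow> bool"
  assumes eta_iff: "\<eta> A b \<longleftrightarrow>
      (\<exists>C. \<eta> C A) \<and> (\<forall>C D. \<eta> C A \<and> \<eta> D A \<longrightarrow> \<eta> C D) \<and> (\<forall>C. \<eta> C A \<longrightarrow> \<eta> C b)"
    \<comment> \<open>Interchangeability in arbitrary contexts is equality in HOL.\<close>
    and extensionality: "(\<And>P. \<eta> P a \<longleftrightarrow> \<eta> P b) \<Longrightarrow> a = b"
begin

definition individual :: "'n \<Rightarrow> bool"
  where "individual A \<longleftrightarrow> \<eta> A A"

definition singular_eq :: "'n \<Rightarrow> 'n \<Rightarrow> bool"  (infix \<open>\<doteq>\<close> 50)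
  where "P \<doteq> Q \<longleftrightarrow> \<eta> P Q \<and> \<eta> Q P"

definition name_eq :: "'n \<Rightarrow> 'n \<Rightarrow> bool"  (infix \<open>\<approx>\<close> 50)
  where "a \<approx> b \<longleftrightarrow> (\<forall>P. \<eta> P a \<longleftrightarrow> \<eta> P b)"

definition name_incl :: "'n \<Rightarrow> 'n \<Rightarrow> bool"  (infix \<open>\<sqsubseteq>\<close> 50)
  where "a \<sqsubseteq> b \<longleftrightarrow> (\<forall>P. \<eta> P a \<longrightarrow> \<eta> P b)"

end

locale mereology = ontology \<eta>
  for \<eta> :: "'n \<Rightarrow> 'n \<Rightarrow> bool" +
  fixes pt ppt ext klass :: "'n \<Rightarrow> 'n"
  assumes pt_individual: "\<eta> P (pt Q) \<Longrightarrow> individual P \<and> individual Q"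
    and pt_refl: "individual P \<Longrightarrow> \<eta> P (pt P)"
    and pt_trans: "\<eta> P (pt Q) \<Longrightarrow> \<eta> Q (pt R) \<Longrightarrow> \<eta> P (pt R)"
    and pt_antisym: "\<eta> P (pt Q) \<Longrightarrow> \<eta> Q (pt P) \<Longrightarrow> P \<doteq> Q"
    and ppt_iff: "\<eta> P (ppt Q) \<longleftrightarrow> \<eta> P (pt Q) \<and> \<not> P \<doteq> Q"
    and ext_iff: "\<eta> P (ext Q) \<longleftrightarrow>
      individual P \<and> individual Q \<and> \<not> (\<exists>R. \<eta> R (pt P) \<and> \<eta> R (pt Q))"
    and klass_iff: "\<eta> A (klass a) \<longleftrightarrow>
      individual A \<and> (\<forall>B. \<eta> B a \<longrightarrow> \<eta> B (pt A)) \<and>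
      (\<forall>B. \<eta> B (pt A) \<longrightarrow> (\<exists>C D. \<eta> C a \<and> \<eta> D (pt C) \<and> \<eta> D (pt B)))"
    and klass_ex: "\<eta> C a \<Longrightarrow> \<exists>A. \<eta> A (klass a)"
    and klass_unique: "\<eta> A (klass a) \<Longrightarrow> \<eta> B (klass a) \<Longrightarrow> A \<doteq> B"

text \<open>That balls are individuals follows from the axiom of Ontology.\<close>

locale ball_mereology = mereology \<eta> pt ppt ext klass
  for \<eta> :: "'n \<Rightarrow> 'n \<Rightarrow> bool" and pt ppt ext klass :: "'n \<Rightarrow> 'n" +
  fixes balls :: 'n
  assumes ball_ex: "\<exists>B. \<eta> B balls"
begin

definition ext_tangent :: "'n \<Rightarrow> 'n \<Rightarrow> bool"
  where "ext_tangent A B \<longleftrightarrow> \<eta> A balls \<and> \<eta> B balls \<and> \<eta> A (ext B) \<and>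
    (\<forall>X Y. \<eta> X balls \<and> \<eta> Y balls \<and> \<eta> A (pt X) \<and> \<eta> X (ext B) \<and> \<eta> A (pt Y) \<and> \<eta> Y (ext B)
      \<longrightarrow> \<eta> X (pt Y) \<or> \<eta> Y (pt X))"

definition int_tangent :: "'n \<Rightarrow> 'n \<Rightarrow> bool"
  where "int_tangent A B \<longleftrightarrow> \<eta> A balls \<and> \<eta> B balls \<and> \<eta> A (ppt B) \<and>
    (\<forall>X Y. \<eta> X balls \<and> \<eta> Y balls \<and> \<eta> A (pt X) \<and> \<eta> X (pt B) \<and> \<eta> A (pt Y) \<and> \<eta> Y (pt B)
      \<longrightarrow> \<eta> X (pt Y) \<or> \<eta> Y (pt X))"

definition ext_diametrical :: "'n \<Rightarrow> 'n \<Rightarrow> 'n \<Rightarrow> bool"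
  where "ext_diametrical A B C \<longleftrightarrow> ext_tangent A C \<and> ext_tangent B C \<and>
    (\<forall>X Y. \<eta> X balls \<and> \<eta> Y balls \<and> \<eta> X (ext C) \<and> \<eta> Y (ext C) \<and> \<eta> A (pt X) \<and> \<eta> B (pt Y)
      \<longrightarrow> \<eta> X (ext Y))"

definition int_diametrical :: "'n \<Rightarrow> 'n \<Rightarrow> 'n \<Rightarrow> bool"
  where "int_diametrical A B C \<longleftrightarrow> int_tangent A C \<and> int_tangent B C \<and>
    (\<forall>X Y. \<eta> X balls \<and> \<eta> Y balls \<and> \<eta> X (ext C) \<and> \<eta> Y (ext C) \<and>
      ext_tangent A X \<and> ext_tangent B Y \<longrightarrow> \<eta> X (ext Y))"

definition inner_concentric :: "'n \<Rightarrow> 'n \<Rightarrow> bool"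
  where "inner_concentric P Q \<longleftrightarrow> \<eta> P (ppt Q) \<and>
    (\<forall>X Y. \<eta> X balls \<and> \<eta> Y balls \<and> ext_diametrical X Y P \<and> int_tangent X Q \<and> int_tangent Y Q
      \<longrightarrow> int_diametrical X Y Q)"

end

locale tarski_geometry = ball_mereology \<eta> pt ppt ext klass balls
  for \<eta> :: "'n \<Rightarrow> 'n \<Rightarrow> bool" and pt ppt ext klass :: "'n \<Rightarrow> 'n" and balls :: 'n +
  fixes Concent Point :: "'n \<Rightarrow> 'n"
    and Solid Gspace :: 'n
    and sat_InteriorPoint InteriorG :: "'n \<Rightarrow> 'n"
  assumes Concent_iff: "\<eta> P (Concent Q) \<longleftrightarrow> \<eta> P balls \<and> \<eta> Q balls \<and>
      (P \<doteq> Q \<or> inner_concentric P Q \<or> inner_concentric Q P)"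
    and Point_iff: "\<eta> P (Point Q) \<longleftrightarrow> \<eta> P balls \<and> \<eta> Q balls \<and> \<eta> P (Concent Q)"
    and Concent_equiv: "equiv {P. \<eta> P balls} {(P, Q). \<eta> P (Concent Q)}"
    and Concent_Point: "\<eta> P (Concent Q) \<Longrightarrow> Point P \<approx> Point Q"
    and Solid_iff: "\<eta> P Solid \<longleftrightarrow> individual P \<and> (\<exists>b. b \<sqsubseteq> balls \<and> \<eta> P (klass b))"
    and pt_Solid: "\<eta> Q Solid \<Longrightarrow> \<eta> P (pt Q) \<Longrightarrow> \<eta> P Solid"
    and Gspace_iff: "\<eta> P Gspace \<longleftrightarrow> \<eta> P (klass balls)"
    and sat_InteriorPoint_iff: "\<eta> P (sat_InteriorPoint Q) \<longleftrightarrow> \<eta> Q Solid \<and>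
      (\<exists>P'. \<eta> P (Point P') \<and> \<eta> P' (pt Q) \<and> (\<eta> P' (pt P) \<longrightarrow> P \<doteq> P'))"
    and InteriorG_iff: "\<eta> P (InteriorG Q) \<longleftrightarrow> \<eta> P (klass (sat_InteriorPoint Q))"

end

theory Submission
  imports Defs
begin

text \<open>
  Space has no boundary, so the condition by which \<open>sat_InteriorPoint\<close> selects balls selects
  all of them when the solid is space itself. Indeed a ball \<open>P\<close> is concentric with itself and is
  a part of space, so it can serve as its own witness \<open>P'\<close>: the clause that is to keep \<open>P'\<close>
  from being a smaller ball inside \<open>P\<close> then asks only for \<open>P \<doteq> P\<close>. Conversely, only balls can be
  points. Hence the names \<open>sat_InteriorPoint Gspace\<close> and \<open>balls\<close> have the same extension
  (\<open>sat_InteriorPoint_Gspace\<close>), and the interior of space and space itself are the class of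
  one and the same name.

  Singular identity asks in addition that this class designate exactly one object. This is the
  existence and uniqueness of classes, read as a statement about the name \<open>klass a\<close>
  (\<open>individual_klass\<close>); it applies because there is at least one ball.
\<close>

context ontology
begin

text \<open>
  For \<open>\<eta> A A\<close> the inclusion clause in the axiom of Ontology is trivial, so \<open>A\<close> is an individual as
  soon as it designates something and designates nothing else.
\<close>

lemma individualI:
  assumes "\<eta> C A" and unique: "\<And>C D. \<eta> C A \<Longrightarrow> \<eta> D A \<Longrightarrow> \<eta> C D"
  shows "individual A"
  unfolding individual_def
proof (rule iffD2[OF eta_iff], intro conjI allI impI)
  show "\<exists>C. \<eta> C A"
    using assms(1) by (rule exI)
  show "\<eta> C D" if "\<eta> C A \<and> \<eta> D A" for C D
    using that by (elim conjE) (rule unique)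
qed

lemma eta_individual:
  assumes "\<eta> P a"
  shows "individual P"
proof -
  note axiom = iffD1[OF eta_iff assms]
  from axiom obtain C where C: "\<eta> C P"
    by (elim conjE exE)
  have unique: "\<eta> C D" if "\<eta> C P" "\<eta> D P" for C D
    by (rule axiom[THEN conjunct2, THEN conjunct1, rule_format, OF conjI, OF that])
  show ?thesis
    using C unique by (rule individualI)
qed

lemma singular_eq_refl: "individual P \<Longrightarrow> P \<doteq> P"
  by (simp add: individual_def singular_eq_def)

end

context mereology
begin

text \<open>
  The members of \<open>klass a\<close> are the objects that are the class of \<open>a\<close>. Existence and uniqueness of
  that object are what the axiom of Ontology requires for the name itself to be singular.
\<close>

lemma individual_klass:
  assumes "\<eta> C a"
  shows "individual (klass a)"
proof -
  obtain A where A: "\<eta> A (klass a)"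
    using klass_ex[OF assms] ..
  have unique: "\<eta> A B" if "\<eta> A (klass a)" "\<eta> B (klass a)" for A B
    using klass_unique[OF that] by (simp only: singular_eq_def)
  show ?thesis
    using A unique by (rule individualI)
qed

end

context tarski_geometry
begin

lemma Gspace_eq_klass_balls: "Gspace = klass balls"
  by (rule extensionality) (rule Gspace_iff)

lemma individual_Gspace: "individual Gspace"
  unfolding Gspace_eq_klass_balls using ball_ex by (elim exE) (rule individual_klass)

lemma Gspace_klass_balls: "\<eta> Gspace (klass balls)"
  using individual_Gspace by (simp only: individual_def flip: Gspace_eq_klass_balls)

lemma ball_part_Gspace: "\<eta> P balls \<Longrightarrow> \<eta> P (pt Gspace)"
  using Gspace_klass_balls by (simp only: klass_iff)

lemma Solid_Gspace: "\<eta> Gspace Solid"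
  unfolding Solid_iff name_incl_def using individual_Gspace Gspace_klass_balls by blast

lemma Point_refl: "\<eta> P balls \<Longrightarrow> \<eta> P (Point P)"
  by (simp add: Point_iff Concent_iff singular_eq_refl eta_individual)

lemma sat_InteriorPoint_Gspace: "sat_InteriorPoint Gspace = balls"
proof (rule extensionality)
  show "\<eta> P (sat_InteriorPoint Gspace) \<longleftrightarrow> \<eta> P balls" for P
  proof
    assume "\<eta> P (sat_InteriorPoint Gspace)"
    then show "\<eta> P balls"
      by (auto simp only: sat_InteriorPoint_iff Point_iff)
  next
    assume ball: "\<eta> P balls"
    have "\<eta> P (Point P)" "\<eta> P (pt Gspace)" "P \<doteq> P"
      using Point_refl[OF ball] ball_part_Gspace[OF ball]
        singular_eq_refl[OF eta_individual[OF ball]] .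
    then show "\<eta> P (sat_InteriorPoint Gspace)"
      unfolding sat_InteriorPoint_iff using Solid_Gspace by blast
  qed
qed

lemma InteriorG_Gspace: "InteriorG Gspace = Gspace"
  by (rule extensionality) (simp only: InteriorG_iff sat_InteriorPoint_Gspace Gspace_iff)

end

theorem theorem11:
  fixes \<eta> :: "'n \<Rightarrow> 'n \<Rightarrow> bool"
    and pt ppt ext klass :: "'n \<Rightarrow> 'n" and balls :: 'n
    and Concent Point :: "'n \<Rightarrow> 'n" and Solid Gspace :: 'n
    and sat_InteriorPoint InteriorG :: "'n \<Rightarrow> 'n"
  assumes "tarski_geometry \<eta> pt ppt ext klass balls Concent Point Solid Gspace
    sat_InteriorPoint InteriorG"
  shows "ontology.singular_eq \<eta> (InteriorG Gspace) Gspace"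
proof -
  interpret tarski_geometry \<eta> pt ppt ext klass balls Concent Point Solid Gspace
      sat_InteriorPoint InteriorG
    using assms .
  show ?thesis
    using singular_eq_refl[OF individual_Gspace] by (simp add: InteriorG_Gspace)
qed

end
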